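(* Let $\mathcal{M}$ be a finite-horizon Dec-POMDP with agent set $\mathcal{N}$ and an environment agent, satisfying the independence assumptions stated in the context, and fix a joint policy $\boldsymbol{\pi}=\langle\pi_1,\dots,\pi_N\rangle$ with its induced stochastic process. Let $X_e=S_{e,0:T}$ be the environment state sequence, let $Z=f(X_e)$ be a secret variable, where $f$ is a surjective function, and for $A\subseteq\mathcal{N}$ let $Y_A=\{O_{i,0:T}: i\in A\}$ denote the joint observations collected by the agent set $A$. Let $$g(A):=I(Z;Y_A).$$ Then $g(\cdot)$ is monotone and $\epsilon$-approximately submodular, i.e., there exists a submodular function $$h(A):=I(X_e;Y_A)$$ such that for all $A\subseteq\mathcal{N}$, $$(1-\epsilon)\,h(A)\ \le\ g(A)\ \le\ (1+\epsilon)\,h(A),$$ where $$\epsilon:=\max_{A}\ \frac{I(X_e;Y_A\mid Z)}{I(X_e;Y_A)}\ \in(0,1].$$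
   Context: **Dec-POMDP.** $\mathcal{M}=\langle T,\mathcal{N},\mathcal{S},\mathcal{A},\mathcal{O},P,\mu,\{E_i\}\rangle$: horizon $T\in\mathbb{N}$; agents $\mathcal{N}=\{1,\dots,N\}$; finite state set $\mathcal{S}$; joint action set $\mathcal{A}=\prod_i\mathcal{A}_i$ and joint observation set $\mathcal{O}=\prod_i\mathcal{O}_i$ (all finite); transition function $P:\mathcal{S}\times\mathcal{A}\to\mathcal{D}(\mathcal{S})$, where $\mathcal{D}(\cdot)$ denotes the set of probability distributions; initial distribution $\mu$; emission functions $E_i:\mathcal{S}\to\mathcal{D}(\mathcal{O}_i)$. A policy of agent $i$ is a map $\pi_i$ sending each local history $(o_{i,0},a_{i,0},o_{i,1},\dots,o_{i,t})$ to a distribution on $\mathcal{A}_i$. A joint policy $\langle\pi_1,\dots,\pi_N\rangle$ induces a stochastic process of states, actions and observations: $S_0\sim\mu$; at time $t$ agent $i$ observes $O_{i,t}\sim E_i(S_t)$ and draws $A_{i,t}\sim\pi_i(\cdot\mid O_{i,0:t},A_{i,0:t-1})$ (each agent knows its own action but not those of others); and $S_{t+1}\sim P(S_t,A_t)$ with $A_t=\langle A_{1,t},\dots,A_{N,t}\rangle$. **Independence assumptions.** For any $s\in\mathcal{S}$ and any $i,j\in\mathcal{N}$ with $i\ne j$, agent $i$'s observation (distributed as $E_i(s)$) is conditionally independent of agent $j$'s observation (distributed as $E_j(s)$) given the state $s$. Each joint state is $s=\langle s_e,s_1,\dots,s_N\rangle$, with $s_e$ the state of an uncontrolled environment agent and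 $s_i$ the state of agent $i$. There are transition functions $P_e,P_1,\dots,P_N$ with $$P((s_e',s_1',\dots,s_N')\mid(s_e,s_1,\dots,s_N),(a_1,\dots,a_N))=P_e(s_e'\mid s_e)\prod_{i=1}^N P_i(s_i'\mid s_i,a_i);$$ the initial distribution factors as $\mu_{0,e}(s_e)\prod_{i=1}^N\mu_{0,i}(s_i)$; and $E_i(s_e,s_1,\dots,s_N)$ depends only on $(s_e,s_i)$. $I(\cdot;\cdot)$ and $I(\cdot;\cdot\mid\cdot)$ are mutual information and conditional mutual information. A set function $h$ on subsets of $\mathcal{N}$ is monotone if $h(A)\le h(B)$ for $A\subseteq B$, and submodular if $h(A\cup\{j\})-h(A)\ge h(B\cup\{j\})-h(B)$ for $A\subseteq B$, $j\notin B$.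
   Formalization: ε ∈ (0,1] fails when f is injective (ε = 0); proved instead: ε ∈ [0,1], and ε ∈ (0,1] exactly when I(X_e;Y_A|Z) > 0 for some A. Ratios 0/0 (e.g. A = ∅) count as 0. Observations are taken jointly, not just pairwise, independent given the state. *)

theory Defs
  imports "HOL-Probability.Probability"
begin

section \<open>Dec-POMDPs\<close>

text \<open>
  The agents are the elements of a finite type \<open>'i\<close>. The finite sets of actions and observations
  of the individual agents are subsets of common finite types \<open>'a\<close> and \<open>'o\<close>, so that joint actions
  and joint observations are functions on the agents. Transition, emission and policy functions are
  only constrained on the sets they are meant to be applied to.
\<close>

record ('s, 'i, 'a, 'o) dec_pomdp =
  horizon :: nat
  states :: "'s set"
  acts :: "'i \<Rightarrow> 'a set"
  obss :: "'i \<Rightarrow> 'o set"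
  trans_prob :: "'s \<Rightarrow> ('i \<Rightarrow> 'a) \<Rightarrow> 's pmf"
  init_prob :: "'s pmf"
  emit :: "'i \<Rightarrow> 's \<Rightarrow> 'o pmf"

definition valid_dec_pomdp ::
  "('s::finite, 'i::finite, 'a::finite, 'o::finite) dec_pomdp \<Rightarrow> bool" where
  "valid_dec_pomdp M \<longleftrightarrow>
     set_pmf (init_prob M) \<subseteq> states M \<and>
     (\<forall>s \<in> states M. \<forall>a. (\<forall>i. a i \<in> acts M i) \<longrightarrow> set_pmf (trans_prob M s a) \<subseteq> states M) \<and>
     (\<forall>s \<in> states M. \<forall>i. set_pmf (emit M i s) \<subseteq> obss M i)"

text \<open>
  A local history \<open>(o\<^sub>0, a\<^sub>0, o\<^sub>1, \<dots>, o\<^sub>t)\<close> is given by the list \<open>[o\<^sub>0, \<dots>, o\<^sub>t]\<close> of observations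
  and the list \<open>[a\<^sub>0, \<dots>, a\<^sub>t\<^sub>-\<^sub>1]\<close> of the agent's own actions.
\<close>

type_synonym ('a, 'o) policy = "'o list \<Rightarrow> 'a list \<Rightarrow> 'a pmf"

definition valid_policy ::
  "('s, 'i, 'a, 'o) dec_pomdp \<Rightarrow> 'i \<Rightarrow> ('a, 'o) policy \<Rightarrow> bool" where
  "valid_policy M i p \<longleftrightarrow>
     (\<forall>os as. set os \<subseteq> obss M i \<and> set as \<subseteq> acts M i \<and>
        length os = Suc (length as) \<and> length as \<le> horizon M \<longrightarrow>
        set_pmf (p os as) \<subseteq> acts M i)"

text \<open>
  The emission functions only give the law of each single observation. The law of the joint
  observation in a state is a further kernel \<open>J\<close> with the emission functions as marginals; the
  conditional independence assumption below is an assumption about \<open>J\<close>.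
\<close>

definition joint_emission ::
  "('s, 'i, 'a, 'o) dec_pomdp \<Rightarrow> ('s \<Rightarrow> ('i \<Rightarrow> 'o) pmf) \<Rightarrow> bool" where
  "joint_emission M J \<longleftrightarrow>
     (\<forall>s \<in> states M. \<forall>i. map_pmf (\<lambda>obs. obs i) (J s) = emit M i s)"

text \<open>
  Given the state, the observations of the agents are independent. This is independence of the
  whole family of observations: independence of each pair of observations alone would allow three
  agents to observe independent fair bits \<open>b\<^sub>1\<close>, \<open>b\<^sub>2\<close> and \<open>b\<^sub>1 + b\<^sub>2 + s\<close> modulo 2 in an
  environment state \<open>s\<close>, and then the information about \<open>s\<close> is not submodular.
\<close>

definition cond_indep_observations ::
  "('s, 'i, 'a, 'o) dec_pomdp \<Rightarrow> ('s \<Rightarrow> ('i \<Rightarrow> 'o) pmf) \<Rightarrow> bool" where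
  "cond_indep_observations M J \<longleftrightarrow>
     (\<forall>s \<in> states M. prob_space.indep_vars (measure_pmf (J s))
        (\<lambda>_. count_space UNIV) (\<lambda>i obs. obs i) UNIV)"


section \<open>The induced stochastic process\<close>

type_synonym ('s, 'i, 'a, 'o) step = "'s \<times> ('i \<Rightarrow> 'o) \<times> ('i \<Rightarrow> 'a)"

definition step_state :: "('s, 'i, 'a, 'o) step \<Rightarrow> 's" where
  "step_state x = fst x"

definition step_obs :: "'i \<Rightarrow> ('s, 'i, 'a, 'o) step \<Rightarrow> 'o" where
  "step_obs i x = fst (snd x) i"

definition step_act :: "'i \<Rightarrow> ('s, 'i, 'a, 'o) step \<Rightarrow> 'a" where
  "step_act i x = snd (snd x) i"

text \<open>
  Given the past \<open>h\<close> and the current state \<open>s\<close>: draw the joint observation, then let every agent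
  draw its action independently from its policy at its own local history. The second argument of
  \<^const>\<open>Pi_pmf\<close> is irrelevant for the index set \<^term>\<open>UNIV\<close>.
\<close>

definition extend ::
  "('s \<Rightarrow> ('i \<Rightarrow> 'o) pmf) \<Rightarrow> ('i \<Rightarrow> ('a, 'o) policy) \<Rightarrow>
   ('s, 'i, 'a, 'o) step list \<Rightarrow> 's \<Rightarrow> ('s, 'i, 'a, 'o) step list pmf" where
  "extend J \<pi> h s =
     bind_pmf (J s) (\<lambda>obs.
     bind_pmf (Pi_pmf UNIV undefined
                 (\<lambda>i. \<pi> i (map (step_obs i) h @ [obs i]) (map (step_act i) h))) (\<lambda>act.
     return_pmf (h @ [(s, obs, act)])))"

text \<open>The law of the states, joint observations and joint actions at the times \<open>0, \<dots>, t\<close>.\<close>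

primrec process ::
  "('s, 'i, 'a, 'o) dec_pomdp \<Rightarrow> ('s \<Rightarrow> ('i \<Rightarrow> 'o) pmf) \<Rightarrow> ('i \<Rightarrow> ('a, 'o) policy) \<Rightarrow>
   nat \<Rightarrow> ('s, 'i, 'a, 'o) step list pmf" where
  "process M J \<pi> 0 = bind_pmf (init_prob M) (extend J \<pi> [])"
| "process M J \<pi> (Suc t) =
     bind_pmf (process M J \<pi> t) (\<lambda>h.
     bind_pmf (trans_prob M (step_state (last h)) (\<lambda>i. step_act i (last h))) (\<lambda>s.
     extend J \<pi> h s))"

definition trajectory ::
  "('s, 'i, 'a, 'o) dec_pomdp \<Rightarrow> ('s \<Rightarrow> ('i \<Rightarrow> 'o) pmf) \<Rightarrow> ('i \<Rightarrow> ('a, 'o) policy) \<Rightarrow>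
   ('s, 'i, 'a, 'o) step list pmf" where
  "trajectory M J \<pi> = process M J \<pi> (horizon M)"


section \<open>Independence of the agents and of the environment\<close>

text \<open>A joint state is a pair of an environment state and the family of the agents' states.\<close>

locale factored_dec_pomdp =
  fixes M :: "('e::finite \<times> ('i::finite \<Rightarrow> 'l::finite), 'i, 'a::finite, 'o::finite) dec_pomdp"
    and J :: "'e \<times> ('i \<Rightarrow> 'l) \<Rightarrow> ('i \<Rightarrow> 'o) pmf"
    and Env :: "'e set"
    and Loc :: "'i \<Rightarrow> 'l set"
    and P_env :: "'e \<Rightarrow> 'e pmf"
    and P_loc :: "'i \<Rightarrow> 'l \<Rightarrow> 'a \<Rightarrow> 'l pmf"
    and \<mu>_env :: "'e pmf"
    and \<mu>_loc :: "'i \<Rightarrow> 'l pmf"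
  assumes valid: "valid_dec_pomdp M"
    and joint_emission: "joint_emission M J"
    and cond_indep: "cond_indep_observations M J"
    and states_eq: "states M = {(se, sl). se \<in> Env \<and> (\<forall>i. sl i \<in> Loc i)}"
    and P_env_closed: "\<And>se. se \<in> Env \<Longrightarrow> set_pmf (P_env se) \<subseteq> Env"
    and P_loc_closed: "\<And>i l a. l \<in> Loc i \<Longrightarrow> a \<in> acts M i \<Longrightarrow> set_pmf (P_loc i l a) \<subseteq> Loc i"
    and \<mu>_env_closed: "set_pmf \<mu>_env \<subseteq> Env"
    and \<mu>_loc_closed: "\<And>i. set_pmf (\<mu>_loc i) \<subseteq> Loc i"
    and trans_factored:
      "\<And>se sl a se' sl'. (se, sl) \<in> states M \<Longrightarrow> (\<forall>i. a i \<in> acts M i) \<Longrightarrow> (se', sl') \<in> states M \<Longrightarrow>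
         pmf (trans_prob M (se, sl) a) (se', sl') =
           pmf (P_env se) se' * (\<Prod>i\<in>UNIV. pmf (P_loc i (sl i) (a i)) (sl' i))"
    and init_factored:
      "\<And>se sl. (se, sl) \<in> states M \<Longrightarrow>
         pmf (init_prob M) (se, sl) = pmf \<mu>_env se * (\<Prod>i\<in>UNIV. pmf (\<mu>_loc i) (sl i))"
    and emit_local:
      "\<And>i se sl sl'. (se, sl) \<in> states M \<Longrightarrow> (se, sl') \<in> states M \<Longrightarrow> sl i = sl' i \<Longrightarrow>
         emit M i (se, sl) = emit M i (se, sl')"


section \<open>Random variables on trajectories\<close>

text \<open>
  Trajectories drawn from \<^const>\<open>trajectory\<close> have \<open>horizon M + 1\<close> entries. The time index runs over
  a fixed list, which makes the ranges of these random variables finite although they are defined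
  on all lists.
\<close>

definition env_seq ::
  "('e \<times> ('i \<Rightarrow> 'l), 'i, 'a, 'o) dec_pomdp \<Rightarrow> ('e \<times> ('i \<Rightarrow> 'l), 'i, 'a, 'o) step list \<Rightarrow> 'e list" where
  "env_seq M \<omega> = map (\<lambda>t. fst (step_state (\<omega> ! t))) [0..<Suc (horizon M)]"

definition obs_seqs ::
  "('s, 'i, 'a, 'o) dec_pomdp \<Rightarrow> 'i set \<Rightarrow> ('s, 'i, 'a, 'o) step list \<Rightarrow> 'i \<Rightarrow> 'o list" where
  "obs_seqs M A \<omega> = (\<lambda>i\<in>A. map (\<lambda>t. step_obs i (\<omega> ! t)) [0..<Suc (horizon M)])"


section \<open>Information and set functions\<close>

text \<open>Logarithms are to the base \<open>b\<close>.\<close>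

abbreviation mutual_info :: "real \<Rightarrow> 'w pmf \<Rightarrow> ('w \<Rightarrow> 'x) \<Rightarrow> ('w \<Rightarrow> 'y) \<Rightarrow> real" where
  "mutual_info b p X Y \<equiv> information_space.mutual_information_Pow (measure_pmf p) b X Y"

abbreviation cond_mutual_info ::
  "real \<Rightarrow> 'w pmf \<Rightarrow> ('w \<Rightarrow> 'x) \<Rightarrow> ('w \<Rightarrow> 'y) \<Rightarrow> ('w \<Rightarrow> 'z) \<Rightarrow> real" where
  "cond_mutual_info b p X Y Z \<equiv>
     information_space.conditional_mutual_information_Pow (measure_pmf p) b X Y Z"

definition submodular :: "('i set \<Rightarrow> real) \<Rightarrow> bool" where
  "submodular h \<longleftrightarrow>
     (\<forall>A B j. A \<subseteq> B \<and> j \<notin> B \<longrightarrow> h (insert j A) - h A \<ge> h (insert j B) - h B)"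

text \<open>
  The largest ratio of \<open>c A\<close> to \<open>h A\<close> over all sets of agents. Since \<open>x / 0 = 0\<close>, sets with
  \<open>h A = 0\<close>, such as the empty set in the case of mutual information, contribute the value 0;
  as all ratios are nonnegative there, this is the maximum over the sets with \<open>h A > 0\<close>
  if there are any.
\<close>

definition max_ratio :: "('i::finite set \<Rightarrow> real) \<Rightarrow> ('i set \<Rightarrow> real) \<Rightarrow> real" where
  "max_ratio c h = Max (range (\<lambda>A. c A / h A))"

end

(*
  Given the environment states X, the law of the trajectory is a product over the agents, since
  each agent's observations, actions and local states depend only on its own past and on X. Hence
  the observation sequences are conditionally independent given X, so the information about X
  gained by adding agent j to A equals H(Y_j | Y_A) - H(Y_j | X), which decreases in A because
  conditioning reduces entropy. As Z is a function of X, the chain rule gives h = g + c, and the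
  bounds with epsilon are elementary; g is monotone by data processing.
*)
theory Submission
  imports Defs
begin

text \<open>Two obstacles shape the argument. Policies and local transitions depend on past actions
  and hidden local states, so the environment path and the observations alone do not evolve on their
  own: the product form has to be proved for the full local histories and is restricted to
  observations only at the end. Moreover, the model is constrained only on legal states, actions and
  observations, so kernels may be replaced by products only almost surely, which calls for an
  invariant on the support of the process. On the information side, every quantity becomes a linear
  combination of joint entropies; conditional independence enters cross-multiplied, so that it also
  makes sense for environment paths of probability 0.\<close>

section \<open>Information of random variables with finite range\<close>

context information_space
begin

text \<open>Sums over the ranges of different variables cannot be combined term by term; as
  expectations they live on one space, where the integrands can be added pointwise.\<close>

lemma sum_prob_simple_function:
  assumes W: "simple_function M W"
  shows "(\<Sum>w\<in>W ` space M. prob (W -` {w} \<inter> space M) * F w) = (\<integral>x. F (W x) \<partial>M)"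
proof -
  have W': "simple_distributed M W (\<lambda>w. prob (W -` {w} \<inter> space M))"
    by (rule simple_distributedI[OF W]) auto
  have fin: "finite (W ` space M)"
    using W by (rule simple_functionD)
  have "(\<integral>x. F (W x) \<partial>M) =
      (\<integral>w. prob (W -` {w} \<inter> space M) * F w \<partial>count_space (W ` space M))"
    using distributed_integral[OF simple_distributed[OF W'], of F] by simp
  also have "\<dots> = (\<Sum>w\<in>W ` space M. prob (W -` {w} \<inter> space M) * F w)"
    using fin by (rule lebesgue_integral_count_space_finite)
  finally show ?thesis ..
qed

lemma integrable_simple_comp:
  fixes F :: "'c \<Rightarrow> real"
  assumes "simple_function M W"
  shows "integrable M (\<lambda>x. F (W x))"
proof -
  have sf: "simple_function M (\<lambda>x. F (W x))"
    using simple_function_compose[OF assms, of F] by (simp add: comp_def)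
  then show ?thesis
    by (rule integrable_simple_function) simp
qed

lemma entropy_eq_expectation:
  assumes "simple_function M W"
  shows "\<H>(W) = - (\<integral>x. log b (prob (W -` {W x} \<inter> space M)) \<partial>M)"
proof -
  have "simple_distributed M W (\<lambda>w. prob (W -` {w} \<inter> space M))"
    by (rule simple_distributedI[OF assms]) auto
  from entropy_simple_distributed[OF this] show ?thesis
    by (simp add: sum_prob_simple_function[OF assms, of "\<lambda>w. log b (prob (W -` {w} \<inter> space M))"])
qed

text \<open>Data processing in both directions. Every regrouping of tuples and families below is an
  instance, with \<open>u\<close> and \<open>v\<close> the explicit relabelling and its
  inverse.\<close>

lemma entropy_mutual_determined:
  assumes "simple_function M X" "simple_function M Y"
    and "\<And>x. X x = u (Y x)" "\<And>x. Y x = v (X x)"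
  shows "\<H>(X) = \<H>(Y)"
proof -
  have "X = u \<circ> Y" "Y = v \<circ> X"
    using assms(3,4) by auto
  then show ?thesis
    using entropy_data_processing[OF assms(1), of v] entropy_data_processing[OF assms(2), of u]
    by auto
qed

lemma mutual_information_eq_entropies:
  assumes X: "simple_function M X" and Y: "simple_function M Y"
  shows "\<I>(X ; Y) = \<H>(X) + \<H>(Y) - \<H>(\<lambda>x. (X x, Y x))"
proof -
  have "\<H>(\<lambda>x. (X x, Y x)) = \<H>(\<lambda>x. (Y x, X x))"
    by (rule entropy_mutual_determined[where u = prod.swap and v = prod.swap])
      (simp_all add: simple_function_Pair X Y)
  then show ?thesis
    using mutual_information_eq_entropy_conditional_entropy[OF X Y] entropy_chain_rule[OF Y X]
    by simp
qed

text \<open>Finitely many null fibers have a null union. Almost surely, then, the logarithm of a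
  quotient of such masses splits into a sum.\<close>

lemma AE_prob_fiber_pos:
  assumes W: "simple_function M W"
  shows "AE x in M. 0 < prob (W -` {W x} \<inter> space M)"
proof -
  have "AE x in M. \<forall>w\<in>W ` space M. prob (W -` {w} \<inter> space M) = 0 \<longrightarrow> x \<notin> W -` {w} \<inter> space M"
  proof (rule AE_finite_allI)
    show "finite (W ` space M)"
      using W by (rule simple_functionD)
    fix w
    have "W -` {w} \<inter> space M \<in> events"
      using W by (rule simple_functionD)
    then show "AE x in M. prob (W -` {w} \<inter> space M) = 0 \<longrightarrow> x \<notin> W -` {w} \<inter> space M"
      using prob_eq_0 by (cases "prob (W -` {w} \<inter> space M) = 0") auto
  qed
  then show ?thesis
    by (rule AE_mp) (auto simp: less_le intro!: AE_I2)
qed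

text \<open>Almost everywhere the logarithm of p(x,y,z) p(z) / (p(x,z) p(y,z)) is a signed sum of
  four logarithms, each of which integrates to an entropy up to sign.\<close>

lemma conditional_mutual_information_eq_entropies:
  assumes X: "simple_function M X" and Y: "simple_function M Y" and Z: "simple_function M Z"
  shows "conditional_mutual_information_Pow X Y Z =
    \<H>(\<lambda>x. (X x, Z x)) + \<H>(\<lambda>x. (Y x, Z x)) - \<H>(\<lambda>x. (X x, Y x, Z x)) - \<H>(Z)"
proof -
  note [simp] = X Y Z
  have sf: "simple_function M (\<lambda>x. (X x, Z x))" "simple_function M (\<lambda>x. (Y x, Z x))"
    "simple_function M (\<lambda>x. (X x, Y x, Z x))"
    by (auto intro!: simple_function_Pair)
  define pz where "pz z = prob (Z -` {z} \<inter> space M)" for z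
  define pxz where "pxz w = prob ((\<lambda>x. (X x, Z x)) -` {w} \<inter> space M)" for w
  define pyz where "pyz w = prob ((\<lambda>x. (Y x, Z x)) -` {w} \<inter> space M)" for w
  define pxyz where "pxyz w = prob ((\<lambda>x. (X x, Y x, Z x)) -` {w} \<inter> space M)" for w
  define F where "F = (\<lambda>(x, y, z). log b (pxyz (x, y, z) / (pxz (x, z) * (pyz (y, z) / pz z))))"
  note int = integrable_simple_comp[OF sf(3), of "\<lambda>w. log b (pxyz w)"]
    integrable_simple_comp[OF sf(2), of "\<lambda>w. log b (pyz w)"]
    integrable_simple_comp[OF sf(1), of "\<lambda>w. log b (pxz w)"]
    integrable_simple_comp[OF Z, of "\<lambda>w. log b (pz w)"]
  have "conditional_mutual_information_Pow X Y Z =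
      (\<Sum>w\<in>(\<lambda>x. (X x, Y x, Z x)) ` space M. prob ((\<lambda>x. (X x, Y x, Z x)) -` {w} \<inter> space M) * F w)"
    by (subst conditional_mutual_information_eq[of Z pz Y pyz X pxz pxyz])
      (auto intro!: simple_distributedI simple_function_Pair sum.cong
        simp: pz_def pxz_def pyz_def pxyz_def F_def)
  also have "\<dots> = (\<integral>x. F (X x, Y x, Z x) \<partial>M)"
    by (rule sum_prob_simple_function[OF sf(3)])
  also have "\<dots> = (\<integral>x. log b (pxyz (X x, Y x, Z x)) + log b (pz (Z x))
      - log b (pxz (X x, Z x)) - log b (pyz (Y x, Z x)) \<partial>M)"
  proof (rule integral_cong_AE)
    show "(\<lambda>x. F (X x, Y x, Z x)) \<in> borel_measurable M"
      using integrable_simple_comp[OF sf(3), of F] by (rule borel_measurable_integrable)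
    show "(\<lambda>x. log b (pxyz (X x, Y x, Z x)) + log b (pz (Z x))
      - log b (pxz (X x, Z x)) - log b (pyz (Y x, Z x))) \<in> borel_measurable M"
      using int by (intro borel_measurable_integrable Bochner_Integration.integrable_diff
          Bochner_Integration.integrable_add)
    show "AE x in M. F (X x, Y x, Z x) = log b (pxyz (X x, Y x, Z x)) + log b (pz (Z x))
      - log b (pxz (X x, Z x)) - log b (pyz (Y x, Z x))"
      using AE_prob_fiber_pos[OF sf(1)] AE_prob_fiber_pos[OF sf(2)] AE_prob_fiber_pos[OF sf(3)]
        AE_prob_fiber_pos[OF Z]
    proof eventually_elim
      case (elim x)
      then have "0 < pxz (X x, Z x)" "0 < pyz (Y x, Z x)" "0 < pxyz (X x, Y x, Z x)" "0 < pz (Z x)"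
        by (simp_all add: pxz_def pyz_def pxyz_def pz_def)
      then show ?case
        by (simp add: F_def log_divide log_mult)
    qed
  qed
  also have "\<dots> = (\<integral>x. log b (pxyz (X x, Y x, Z x)) \<partial>M) + (\<integral>x. log b (pz (Z x)) \<partial>M)
      - (\<integral>x. log b (pxz (X x, Z x)) \<partial>M) - (\<integral>x. log b (pyz (Y x, Z x)) \<partial>M)"
    using int by simp
  also have "\<dots> = \<H>(\<lambda>x. (X x, Z x)) + \<H>(\<lambda>x. (Y x, Z x)) - \<H>(\<lambda>x. (X x, Y x, Z x)) - \<H>(Z)"
    by (simp add: entropy_eq_expectation sf pxyz_def pxz_def pyz_def pz_def)
  finally show ?thesis .
qed

lemma entropy_strong_subadditive:
  assumes "simple_function M X" "simple_function M Y" "simple_function M Z"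
  shows "\<H>(\<lambda>x. (X x, Y x, Z x)) + \<H>(Z) \<le> \<H>(\<lambda>x. (X x, Z x)) + \<H>(\<lambda>x. (Y x, Z x))"
  using conditional_mutual_information_nonneg[OF assms]
    conditional_mutual_information_eq_entropies[OF assms] by simp

text \<open>The hypothesis \<open>ci\<close> makes every summand of I(X;Y|Z) vanish; its
  cross-multiplied form covers values \<open>z\<close> of probability 0.\<close>

lemma entropy_cond_indep:
  assumes X: "simple_function M X" and Y: "simple_function M Y" and Z: "simple_function M Z"
    and ci: "\<And>x y z.
      prob {\<omega> \<in> space M. X \<omega> = x \<and> Y \<omega> = y \<and> Z \<omega> = z} * prob {\<omega> \<in> space M. Z \<omega> = z} =
      prob {\<omega> \<in> space M. X \<omega> = x \<and> Z \<omega> = z} * prob {\<omega> \<in> space M. Y \<omega> = y \<and> Z \<omega> = z}"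
  shows "\<H>(\<lambda>x. (X x, Y x, Z x)) + \<H>(Z) = \<H>(\<lambda>x. (X x, Z x)) + \<H>(\<lambda>x. (Y x, Z x))"
proof -
  note [simp] = X Y Z
  define pz where "pz z = prob {\<omega> \<in> space M. Z \<omega> = z}" for z
  define pxz where "pxz w = prob {\<omega> \<in> space M. X \<omega> = fst w \<and> Z \<omega> = snd w}" for w
  define pyz where "pyz w = prob {\<omega> \<in> space M. Y \<omega> = fst w \<and> Z \<omega> = snd w}" for w
  define pxyz where
    "pxyz w = prob {\<omega> \<in> space M. X \<omega> = fst w \<and> Y \<omega> = fst (snd w) \<and> Z \<omega> = snd (snd w)}" for w
  have "pxyz w * log b (pxyz w / (pxz (fst w, snd (snd w)) * (pyz (snd w) / pz (snd (snd w))))) = 0" for w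
  proof -
    obtain x y z where w: "w = (x, y, z)" by (cases w)
    have "pxyz (x, y, z) * pz z = pxz (x, z) * pyz (y, z)"
      using ci[of x y z] by (simp add: pxyz_def pxz_def pyz_def pz_def)
    \<comment> \<open>A nonzero joint mass thus forces \<open>pz z\<close> to be nonzero, and the
      argument of the logarithm is exactly 1.\<close>
    moreover have "pxyz w \<le> pz z"
      unfolding pxyz_def pz_def w using simple_functionD(2)[OF Z, of "{z}"]
      by (intro finite_measure_mono) (auto simp: vimage_def Int_def conj_commute)
    moreover have "0 \<le> pxyz w" by (simp add: pxyz_def)
    ultimately show ?thesis
      by (cases "pxyz w = 0") (auto simp: w divide_simps)
  qed
  then have "conditional_mutual_information_Pow X Y Z = 0"
    by (subst conditional_mutual_information_eq[of Z pz Y pyz X pxz pxyz])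
      (auto intro!: simple_distributedI simple_function_Pair sum.neutral arg_cong[where f = prob]
        simp: pz_def pxz_def pyz_def pxyz_def)
  then show ?thesis
    using conditional_mutual_information_eq_entropies[OF X Y Z] by simp
qed

text \<open>In every tuple that contains X the entry f(X) is redundant; dropping it leaves the same
  combination of entropies on both sides.\<close>

lemma mutual_information_chain_rule:
  assumes X: "simple_function M X" and Y: "simple_function M Y"
  shows "\<I>(X ; Y) = \<I>(\<lambda>x. f (X x) ; Y) + conditional_mutual_information_Pow X Y (\<lambda>x. f (X x))"
proof -
  have fX: "simple_function M (\<lambda>x. f (X x))"
    using simple_function_compose[OF X, of f] by (simp add: comp_def)
  have "\<H>(\<lambda>x. (X x, f (X x))) = \<H>(X)"
    by (rule entropy_mutual_determined[where u = "\<lambda>x. (x, f x)" and v = fst])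
      (simp_all add: X fX simple_function_Pair)
  moreover have "\<H>(\<lambda>x. (X x, Y x, f (X x))) = \<H>(\<lambda>x. (X x, Y x))"
    by (rule entropy_mutual_determined[where u = "\<lambda>(x, y). (x, y, f x)" and v = "\<lambda>(x, y, z). (x, y)"])
      (simp_all add: X Y fX simple_function_Pair)
  moreover have "\<H>(\<lambda>x. (Y x, f (X x))) = \<H>(\<lambda>x. (f (X x), Y x))"
    by (rule entropy_mutual_determined[where u = prod.swap and v = prod.swap])
      (simp_all add: Y fX simple_function_Pair)
  ultimately show ?thesis
    by (simp add: mutual_information_eq_entropies conditional_mutual_information_eq_entropies X Y fX)
qed

text \<open>Strong subadditivity conditioned on f(Y), where f(Y) is redundant next to Y.\<close>

lemma mutual_information_data_processing:
  assumes X: "simple_function M X" and Y: "simple_function M Y"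
  shows "\<I>(X ; \<lambda>x. f (Y x)) \<le> \<I>(X ; Y)"
proof -
  have fY: "simple_function M (\<lambda>x. f (Y x))"
    using simple_function_compose[OF Y, of f] by (simp add: comp_def)
  have "\<H>(\<lambda>x. (Y x, f (Y x))) = \<H>(Y)"
    by (rule entropy_mutual_determined[where u = "\<lambda>y. (y, f y)" and v = fst])
      (simp_all add: Y fY simple_function_Pair)
  moreover have "\<H>(\<lambda>x. (X x, Y x, f (Y x))) = \<H>(\<lambda>x. (X x, Y x))"
    by (rule entropy_mutual_determined[where u = "\<lambda>(x, y). (x, y, f y)" and v = "\<lambda>(x, y, z). (x, y)"])
      (simp_all add: X Y fY simple_function_Pair)
  ultimately show ?thesis
    using entropy_strong_subadditive[OF X Y fY]
    by (simp add: mutual_information_eq_entropies X Y fY)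
qed

lemma submodular_mutual_information_cond_indep:
  fixes Y :: "'i \<Rightarrow> 'a \<Rightarrow> 'c"
  assumes X: "simple_function M X" and Y: "\<And>A. simple_function M (\<lambda>\<omega>. \<lambda>i\<in>A. Y i \<omega>)"
    and ci: "\<And>A j y u x. j \<notin> A \<Longrightarrow>
      prob {\<omega> \<in> space M. Y j \<omega> = y \<and> (\<lambda>i\<in>A. Y i \<omega>) = u \<and> X \<omega> = x} * prob {\<omega> \<in> space M. X \<omega> = x} =
      prob {\<omega> \<in> space M. Y j \<omega> = y \<and> X \<omega> = x} * prob {\<omega> \<in> space M. (\<lambda>i\<in>A. Y i \<omega>) = u \<and> X \<omega> = x}"
  shows "submodular (\<lambda>A. \<I>(X ; (\<lambda>\<omega>. \<lambda>i\<in>A. Y i \<omega>)))"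
proof -
  have Yj: "simple_function M (Y j)" for j
    using simple_function_compose[OF Y[of "{j}"], of "\<lambda>F. F j"] by (simp add: comp_def)
  note sf = X Y Yj simple_function_Pair
  \<comment> \<open>\<open>u\<close> takes the value at \<open>j\<close> from the first component,
    so the correspondence also holds when \<open>j\<close> already lies in \<open>A\<close>.\<close>
  have H_insert: "\<H>(\<lambda>\<omega>. \<lambda>i\<in>insert j A. Y i \<omega>) = \<H>(\<lambda>\<omega>. (Y j \<omega>, \<lambda>i\<in>A. Y i \<omega>))" for j A
    by (rule entropy_mutual_determined[where v = "\<lambda>F. (F j, \<lambda>i\<in>A. F i)" and
          u = "\<lambda>(y, F). \<lambda>i\<in>insert j A. if i = j then y else F i"])
      (simp_all add: sf, auto simp: restrict_def)
  have H_insert_X: "\<H>(\<lambda>\<omega>. (X \<omega>, \<lambda>i\<in>insert j A. Y i \<omega>)) = \<H>(\<lambda>\<omega>. (Y j \<omega>, (\<lambda>i\<in>A. Y i \<omega>), X \<omega>))" for j A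
    by (rule entropy_mutual_determined[where v = "\<lambda>(x, F). (F j, (\<lambda>i\<in>A. F i), x)" and
          u = "\<lambda>(y, F, x). (x, \<lambda>i\<in>insert j A. if i = j then y else F i)"])
      (simp_all add: sf, auto simp: restrict_def)
  have H_swap: "\<H>(\<lambda>\<omega>. (X \<omega>, \<lambda>i\<in>A. Y i \<omega>)) = \<H>(\<lambda>\<omega>. (\<lambda>i\<in>A. Y i \<omega>, X \<omega>))" for A
    by (rule entropy_mutual_determined[where u = prod.swap and v = prod.swap]) (simp_all add: sf)
  \<comment> \<open>Conditional independence splits the entropy of \<open>Y j\<close>, the family on
    \<open>A\<close> and \<open>X\<close>, leaving \<open>Y j\<close> and \<open>X\<close> together
    in a term free of \<open>A\<close>.\<close>
  have gain: "\<I>(X ; (\<lambda>\<omega>. \<lambda>i\<in>insert j A. Y i \<omega>)) - \<I>(X ; (\<lambda>\<omega>. \<lambda>i\<in>A. Y i \<omega>)) =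
      \<H>(\<lambda>\<omega>. (Y j \<omega>, \<lambda>i\<in>A. Y i \<omega>)) - \<H>(\<lambda>\<omega>. \<lambda>i\<in>A. Y i \<omega>) - \<H>(\<lambda>\<omega>. (Y j \<omega>, X \<omega>)) + \<H>(X)"
    if "j \<notin> A" for j A
    using entropy_cond_indep[OF Yj Y X ci[OF that]]
    by (simp add: mutual_information_eq_entropies sf H_insert H_insert_X H_swap)
  \<comment> \<open>Strong subadditivity of \<open>Y j\<close> and the family on \<open>B\<close>
    given the family on \<open>A\<close>; the latter is a restriction of the family on
    \<open>B\<close>, hence redundant beside it.\<close>
  have gain_antimono: "\<H>(\<lambda>\<omega>. (Y j \<omega>, \<lambda>i\<in>B. Y i \<omega>)) - \<H>(\<lambda>\<omega>. \<lambda>i\<in>B. Y i \<omega>) \<le>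
      \<H>(\<lambda>\<omega>. (Y j \<omega>, \<lambda>i\<in>A. Y i \<omega>)) - \<H>(\<lambda>\<omega>. \<lambda>i\<in>A. Y i \<omega>)" if "A \<subseteq> B" for A B j
  proof -
    have "\<H>(\<lambda>\<omega>. (Y j \<omega>, (\<lambda>i\<in>B. Y i \<omega>), (\<lambda>i\<in>A. Y i \<omega>))) = \<H>(\<lambda>\<omega>. (Y j \<omega>, \<lambda>i\<in>B. Y i \<omega>))"
      by (rule entropy_mutual_determined[where v = "\<lambda>(y, F, G). (y, F)" and u = "\<lambda>(y, F). (y, F, \<lambda>i\<in>A. F i)"])
        (use that in \<open>simp_all add: sf, auto simp: restrict_def fun_eq_iff subset_iff\<close>)
    moreover have "\<H>(\<lambda>\<omega>. ((\<lambda>i\<in>B. Y i \<omega>), (\<lambda>i\<in>A. Y i \<omega>))) = \<H>(\<lambda>\<omega>. \<lambda>i\<in>B. Y i \<omega>)"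
      by (rule entropy_mutual_determined[where v = fst and u = "\<lambda>F. (F, \<lambda>i\<in>A. F i)"])
        (use that in \<open>simp_all add: sf, auto simp: restrict_def fun_eq_iff subset_iff\<close>)
    ultimately show ?thesis
      using entropy_strong_subadditive[OF Yj[of j] Y[of B] Y[of A]] by simp
  qed
  show ?thesis
    unfolding submodular_def
  proof (intro allI impI)
    fix A B :: "'i set" and j
    assume AB: "A \<subseteq> B \<and> j \<notin> B"
    then have "j \<notin> A"
      by auto
    then show "\<I>(X ; (\<lambda>\<omega>. \<lambda>i\<in>insert j B. Y i \<omega>)) - \<I>(X ; (\<lambda>\<omega>. \<lambda>i\<in>B. Y i \<omega>)) \<le>
        \<I>(X ; (\<lambda>\<omega>. \<lambda>i\<in>insert j A. Y i \<omega>)) - \<I>(X ; (\<lambda>\<omega>. \<lambda>i\<in>A. Y i \<omega>))"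
      using gain[of j A] gain[of j B] gain_antimono[of A B j] AB by linarith
  qed
qed

end

section \<open>Factorization of the trajectory law\<close>

text \<open>Local state and action are kept because the next local state is drawn from them and the
  policy reads past actions; given the environment states, these triples evolve without reference to
  the other agents.\<close>

definition agent_history ::
  "'i \<Rightarrow> ('e \<times> ('i \<Rightarrow> 'l), 'i, 'a, 'o) step list \<Rightarrow> ('l \<times> 'o \<times> 'a) list" where
  "agent_history i = map (\<lambda>x. (snd (step_state x) i, step_obs i x, step_act i x))"

text \<open>Follows the actual length of the list, unlike \<open>env_seq\<close>, so that appending
  a step appends one environment state.\<close>

definition env_history :: "('e \<times> ('i \<Rightarrow> 'l), 'i, 'a, 'o) step list \<Rightarrow> 'e list" where
  "env_history = map (\<lambda>x. fst (step_state x))"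

lemma nn_integral_pmf_if_eq:
  "(\<integral>\<^sup>+x. (if x = y then F x else 0) \<partial>measure_pmf p) = ennreal (pmf p y) * F y"
  by (subst nn_integral_measure_pmf_support[of "{y}"]) (auto simp: mult.commute)

section \<open>Initial, transition and emission laws as products over the agents\<close>

context factored_dec_pomdp
begin

text \<open>A single joint observation is an intersection of cylinders, one per agent, to which
  independence of the whole family applies. The default \<open>d\<close> is arbitrary since the
  index set is \<open>UNIV\<close>.\<close>

lemma joint_emission_eq_Pi_pmf:
  assumes "s \<in> states M"
  shows "J s = Pi_pmf UNIV d (\<lambda>i. emit M i s)"
proof (rule pmf_eqI)
  fix y
  have indep: "prob_space.indep_vars (measure_pmf (J s)) (\<lambda>_. count_space UNIV) (\<lambda>i obs. obs i) UNIV"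
    using cond_indep assms by (simp add: cond_indep_observations_def)
  have "pmf (J s) y = measure_pmf.prob (J s) {y}"
    by (simp add: measure_pmf_single)
  also have "{y} = (\<Inter>i\<in>UNIV. (\<lambda>obs. obs i) -` {y i} \<inter> space (measure_pmf (J s)))"
    by auto
  also have "measure_pmf.prob (J s) \<dots> = (\<Prod>i\<in>UNIV.
      measure_pmf.prob (J s) ((\<lambda>obs. obs i) -` {y i} \<inter> space (measure_pmf (J s))))"
    by (rule prob_space.indep_varsD_finite[OF prob_space_measure_pmf indep]) auto
  also have "\<dots> = (\<Prod>i\<in>UNIV. pmf (emit M i s) (y i))"
    using joint_emission assms
    by (auto simp: joint_emission_def pmf_map[symmetric])
  finally show "pmf (J s) y = pmf (Pi_pmf UNIV d (\<lambda>i. emit M i s)) y"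
    by (simp add: pmf_Pi)
qed

text \<open>The factorization is given on legal states only. Elsewhere \<open>p\<close> vanishes by
  its support, and so does the product because some coordinate has left its own range.\<close>

lemma pmf_eq_product_on_states:
  fixes p :: "('e \<times> ('i \<Rightarrow> 'l)) pmf"
  assumes "set_pmf p \<subseteq> states M" "set_pmf q \<subseteq> Env" "\<And>i. set_pmf (r i) \<subseteq> Loc i"
    and "\<And>se sl. (se, sl) \<in> states M \<Longrightarrow> pmf p (se, sl) = pmf q se * (\<Prod>i\<in>UNIV. pmf (r i) (sl i))"
  shows "p = pair_pmf q (Pi_pmf UNIV d r)"
proof (rule pmf_eqI)
  fix s :: "'e \<times> ('i \<Rightarrow> 'l)"
  obtain se sl where s: "s = (se, sl)"
    by (cases s)
  show "pmf p s = pmf (pair_pmf q (Pi_pmf UNIV d r)) s"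
  proof (cases "s \<in> states M")
    case True
    then show ?thesis
      using assms(4) s by (simp add: pmf_pair pmf_Pi)
  next
    case False
    then have "pmf p s = 0"
      using assms(1) by (auto simp: set_pmf_eq)
    moreover have "se \<notin> Env \<or> (\<exists>i. sl i \<notin> Loc i)"
      using False by (auto simp: states_eq s)
    then have "pmf q se = 0 \<or> (\<exists>i. pmf (r i) (sl i) = 0)"
      using assms(2,3) by (auto simp: set_pmf_eq subset_iff)
    ultimately show ?thesis
      by (auto simp: s pmf_pair pmf_Pi)
  qed
qed

lemma init_prob_eq: "init_prob M = pair_pmf \<mu>_env (Pi_pmf UNIV d \<mu>_loc)"
  using valid by (intro pmf_eq_product_on_states \<mu>_env_closed \<mu>_loc_closed init_factored)
    (auto simp: valid_dec_pomdp_def)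

lemma trans_prob_eq:
  assumes s: "(se, sl) \<in> states M" and a: "\<forall>i. a i \<in> acts M i"
  shows "trans_prob M (se, sl) a = pair_pmf (P_env se) (Pi_pmf UNIV d (\<lambda>i. P_loc i (sl i) (a i)))"
proof (rule pmf_eq_product_on_states)
  show "set_pmf (trans_prob M (se, sl) a) \<subseteq> states M"
    using valid s a by (simp add: valid_dec_pomdp_def)
  show "set_pmf (P_env se) \<subseteq> Env"
    using s by (intro P_env_closed) (simp add: states_eq)
  show "set_pmf (P_loc i (sl i) (a i)) \<subseteq> Loc i" for i
    using s a by (intro P_loc_closed) (simp_all add: states_eq)
qed (simp add: trans_factored s a)

definition default_loc :: "'i \<Rightarrow> 'l" where
  "default_loc i = (SOME l. l \<in> Loc i)"

text \<open>Locality of emissions is assumed only between legal states, so the other agents'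
  coordinates are filled with fixed legal values.\<close>

definition emit_loc :: "'i \<Rightarrow> 'e \<Rightarrow> 'l \<Rightarrow> 'o pmf" where
  "emit_loc i e l = emit M i (e, default_loc(i := l))"

text \<open>The support of an initial distribution witnesses that \<open>Loc i\<close> is
  nonempty.\<close>

lemma default_loc_in_Loc: "default_loc i \<in> Loc i"
  unfolding default_loc_def using \<mu>_loc_closed[of i] set_pmf_not_empty[of "\<mu>_loc i"]
  by (intro someI_ex[of "\<lambda>l. l \<in> Loc i"]) blast

lemma emit_eq_emit_loc:
  assumes "(se, sl) \<in> states M"
  shows "emit M i (se, sl) = emit_loc i se (sl i)"
  unfolding emit_loc_def using assms default_loc_in_Loc
  by (intro emit_local) (auto simp: states_eq)

section \<open>One step of the process, integrated agent by agent\<close>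

text \<open>The invariant under which the kernels are known. Observations are included because
  \<open>valid_policy\<close> restricts a policy only on legal local histories.\<close>

definition valid_history :: "('e \<times> ('i \<Rightarrow> 'l), 'i, 'a, 'o) step list \<Rightarrow> bool" where
  "valid_history h \<longleftrightarrow>
     (\<forall>x\<in>set h. step_state x \<in> states M \<and> (\<forall>i. step_obs i x \<in> obss M i \<and> step_act i x \<in> acts M i))"

text \<open>The one-agent counterpart of \<open>extend\<close>: the expectation of a test function
  after a single observation and action.\<close>

definition agent_step_integral ::
  "('a, 'o) policy \<Rightarrow> ('l \<times> 'o \<times> 'a) list \<Rightarrow> 'o pmf \<Rightarrow> 'l \<Rightarrow>
   (('l \<times> 'o \<times> 'a) list \<Rightarrow> ennreal) \<Rightarrow> ennreal" where
  "agent_step_integral p k E l \<phi> =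
     (\<integral>\<^sup>+ob. \<integral>\<^sup>+a. \<phi> (k @ [(l, ob, a)])
        \<partial>measure_pmf (p (map (\<lambda>x. fst (snd x)) k @ [ob]) (map (\<lambda>x. snd (snd x)) k)) \<partial>measure_pmf E)"

text \<open>Given the state, the observations are independent, and given these and the past, so are
  the actions. The indicator merely fixes the environment path.\<close>

lemma nn_integral_extend:
  assumes s: "(se, sl) \<in> states M"
  shows "(\<integral>\<^sup>+\<omega>. (if env_history \<omega> = es @ [e] then \<Prod>i\<in>UNIV. \<phi> i (agent_history i \<omega>) else 0)
       \<partial>measure_pmf (extend J \<pi> h (se, sl))) =
     (if env_history h = es \<and> se = e
      then \<Prod>i\<in>UNIV. agent_step_integral (\<pi> i) (agent_history i h) (emit_loc i e (sl i)) (sl i) (\<phi> i)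
      else 0)"
proof -
  have proj: "map (step_obs i) h = map (\<lambda>x. fst (snd x)) (agent_history i h)"
    "map (step_act i) h = map (\<lambda>x. snd (snd x)) (agent_history i h)" for i
    by (simp_all add: agent_history_def)
  have J: "J (se, sl) = Pi_pmf UNIV undefined (\<lambda>i. emit_loc i se (sl i))"
    by (simp add: joint_emission_eq_Pi_pmf[OF s, of undefined] emit_eq_emit_loc[OF s])
  have env: "env_history (h @ [((se, sl), ob, a)]) = env_history h @ [se]" for ob a
    by (simp add: env_history_def step_state_def)
  have agent: "agent_history i (h @ [((se, sl), ob, a)]) = agent_history i h @ [(sl i, ob i, a i)]" for i ob a
    by (simp add: agent_history_def step_state_def step_obs_def step_act_def)
  show ?thesis
  proof (cases "env_history h = es \<and> se = e")
    case True
    then have [simp]: "es = env_history h" "e = se"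
      by simp_all
    define A where "A i ob = \<pi> i (map (step_obs i) h @ [ob]) (map (step_act i) h)" for i ob
    define E where "E = (\<lambda>i. emit_loc i e (sl i))"
    define F where "F i ob a = \<phi> i (agent_history i h @ [(sl i, ob, a)])" for i ob a
    have "(\<integral>\<^sup>+\<omega>. (if env_history \<omega> = es @ [e] then \<Prod>i\<in>UNIV. \<phi> i (agent_history i \<omega>) else 0)
        \<partial>measure_pmf (extend J \<pi> h (se, sl))) =
      (\<integral>\<^sup>+ob. \<integral>\<^sup>+a. (\<Prod>i\<in>UNIV. F i (ob i) (a i))
        \<partial>measure_pmf (Pi_pmf UNIV undefined (\<lambda>i. A i (ob i))) \<partial>measure_pmf (Pi_pmf UNIV undefined E))"
      by (simp add: extend_def env agent J A_def E_def F_def)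
    also have "\<dots> = (\<integral>\<^sup>+ob. (\<Prod>i\<in>UNIV. \<integral>\<^sup>+a. F i (ob i) a \<partial>measure_pmf (A i (ob i)))
        \<partial>measure_pmf (Pi_pmf UNIV undefined E))"
      \<comment> \<open>The actions are integrated first, for fixed observations; the factor
        obtained for \<open>i\<close> depends on \<open>ob i\<close> alone, so the same rule applies
        to the observations.\<close>
      by (intro nn_integral_cong nn_integral_prod_Pi_pmf) simp
    also have "\<dots> = (\<Prod>i\<in>UNIV. \<integral>\<^sup>+ob. \<integral>\<^sup>+a. F i ob a \<partial>measure_pmf (A i ob) \<partial>measure_pmf (E i))"
      by (rule nn_integral_prod_Pi_pmf) simp
    finally show ?thesis
      by (simp add: agent_step_integral_def A_def E_def F_def proj)
  next
    case False
    then show ?thesis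
      by (auto simp: extend_def env)
  qed
qed

text \<open>Abstracting from the origin of \<open>p\<close> lets the initial draw and each
  transition be treated at once.\<close>

lemma nn_integral_new_state_extend:
  assumes "set_pmf p \<subseteq> states M" and p: "p = pair_pmf q (Pi_pmf UNIV undefined r)"
  shows "(\<integral>\<^sup>+s. \<integral>\<^sup>+\<omega>. (if env_history \<omega> = es @ [e] then \<Prod>i\<in>UNIV. \<phi> i (agent_history i \<omega>) else 0)
       \<partial>measure_pmf (extend J \<pi> h s) \<partial>measure_pmf p) =
     (if env_history h = es
      then ennreal (pmf q e) *
        (\<Prod>i\<in>UNIV. \<integral>\<^sup>+l. agent_step_integral (\<pi> i) (agent_history i h) (emit_loc i e l) l (\<phi> i)
          \<partial>measure_pmf (r i))
      else 0)"
proof -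
  let ?\<psi> = "\<lambda>i l. agent_step_integral (\<pi> i) (agent_history i h) (emit_loc i e l) l (\<phi> i)"
  have "(\<integral>\<^sup>+s. \<integral>\<^sup>+\<omega>. (if env_history \<omega> = es @ [e] then \<Prod>i\<in>UNIV. \<phi> i (agent_history i \<omega>) else 0)
       \<partial>measure_pmf (extend J \<pi> h s) \<partial>measure_pmf p) =
     (\<integral>\<^sup>+s. (if env_history h = es \<and> fst s = e then \<Prod>i\<in>UNIV. ?\<psi> i (snd s i) else 0) \<partial>measure_pmf p)"
  proof (rule nn_integral_cong_AE, rule AE_pmfI)
    fix s
    assume "s \<in> set_pmf p"
    then have "(fst s, snd s) \<in> states M"
      using assms(1) by auto
    from nn_integral_extend[OF this]
    show "(\<integral>\<^sup>+\<omega>. (if env_history \<omega> = es @ [e] then \<Prod>i\<in>UNIV. \<phi> i (agent_history i \<omega>) else 0)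
        \<partial>measure_pmf (extend J \<pi> h s)) =
      (if env_history h = es \<and> fst s = e then \<Prod>i\<in>UNIV. ?\<psi> i (snd s i) else 0)"
      by simp
  qed
  also have "\<dots> = (if env_history h = es
      then (\<integral>\<^sup>+se. (if se = e then \<integral>\<^sup>+sl. (\<Prod>i\<in>UNIV. ?\<psi> i (sl i)) \<partial>measure_pmf (Pi_pmf UNIV undefined r) else 0)
        \<partial>measure_pmf q)
      else 0)"
    by (auto simp: p nn_integral_pair_pmf' intro!: nn_integral_cong)
  also have "\<dots> = (if env_history h = es
      then ennreal (pmf q e) * (\<Prod>i\<in>UNIV. \<integral>\<^sup>+l. ?\<psi> i l \<partial>measure_pmf (r i)) else 0)"
    using nn_integral_prod_Pi_pmf[of UNIV undefined r ?\<psi>] by (simp add: nn_integral_pmf_if_eq)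
  finally show ?thesis .
qed

section \<open>Support of the process\<close>

text \<open>The bound on \<open>length h\<close> matches the histories on which
  \<open>valid_policy\<close> constrains a policy: \<open>length h\<close> past actions and, with
  the current one, one more observation.\<close>

lemma extend_support:
  assumes \<pi>: "\<forall>i. valid_policy M i (\<pi> i)" and h: "valid_history h" "length h \<le> horizon M"
    and s: "s \<in> states M" and \<omega>: "\<omega> \<in> set_pmf (extend J \<pi> h s)"
  shows "length \<omega> = Suc (length h) \<and> valid_history \<omega>"
proof -
  obtain ob a where ob: "ob \<in> set_pmf (J s)"
    and a: "a \<in> set_pmf (Pi_pmf UNIV undefined
        (\<lambda>i. \<pi> i (map (step_obs i) h @ [ob i]) (map (step_act i) h)))"
    and \<omega>_eq: "\<omega> = h @ [(s, ob, a)]"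
    using \<omega> by (auto simp: extend_def)
  have "ob \<in> set_pmf (Pi_pmf UNIV undefined (\<lambda>i. emit M i s))"
    using ob by (simp flip: joint_emission_eq_Pi_pmf[OF s])
  then have obs: "ob i \<in> obss M i" for i
    using valid s by (auto simp: set_Pi_pmf PiE_dflt_def valid_dec_pomdp_def subset_iff)
  have "a i \<in> acts M i" for i
  proof -
    have "a i \<in> set_pmf (\<pi> i (map (step_obs i) h @ [ob i]) (map (step_act i) h))"
      using a by (simp add: set_Pi_pmf PiE_dflt_def)
    moreover have "set_pmf (\<pi> i (map (step_obs i) h @ [ob i]) (map (step_act i) h)) \<subseteq> acts M i"
    proof -
      have "set (map (step_obs i) h @ [ob i]) \<subseteq> obss M i" "set (map (step_act i) h) \<subseteq> acts M i"
        using h(1) obs by (auto simp: valid_history_def)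
      then show ?thesis
        using \<pi> h(2) unfolding valid_policy_def by simp
    qed
    ultimately show ?thesis by blast
  qed
  then show ?thesis
    using h(1) s obs by (auto simp: \<omega>_eq valid_history_def step_state_def step_obs_def step_act_def)
qed

lemma trans_prob_last_subset:
  assumes "valid_history h" "h \<noteq> []"
  shows "set_pmf (trans_prob M (step_state (last h)) (\<lambda>i. step_act i (last h))) \<subseteq> states M"
  using assms last_in_set[of h] valid by (auto simp: valid_history_def valid_dec_pomdp_def)

lemma process_support:
  assumes \<pi>: "\<forall>i. valid_policy M i (\<pi> i)" and "t \<le> horizon M" "h \<in> set_pmf (process M J \<pi> t)"
  shows "length h = Suc t \<and> valid_history h"
  using assms(2,3)
proof (induction t arbitrary: h)
  case 0
  then obtain s where "s \<in> set_pmf (init_prob M)" "h \<in> set_pmf (extend J \<pi> [] s)"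
    by auto
  then show ?case
    using extend_support[OF \<pi>, of "[]" s h] valid
    by (auto simp: valid_history_def valid_dec_pomdp_def simp del: split_paired_All)
next
  case (Suc t)
  then obtain h' s where h': "h' \<in> set_pmf (process M J \<pi> t)"
    and s: "s \<in> set_pmf (trans_prob M (step_state (last h')) (\<lambda>i. step_act i (last h')))"
    and h: "h \<in> set_pmf (extend J \<pi> h' s)"
    by auto
  have IH: "length h' = Suc t" "valid_history h'"
    using Suc.IH[OF _ h'] Suc.prems by auto
  then have "h' \<noteq> []"
    by auto
  then have "s \<in> states M"
    using trans_prob_last_subset[of h'] IH s by auto
  then show ?case
    using extend_support[OF \<pi>, of h' s] IH h Suc.prems by auto
qed

text \<open>
  The test functions \<open>\<phi> i\<close> absorb the time steps already taken: integrating out the last step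
  replaces each \<open>\<phi> i\<close> by another function of the agent's history alone, which closes the induction.
  Extended nonnegative reals avoid all integrability side conditions.
\<close>

lemma process_factorizes:
  assumes \<pi>: "\<forall>i. valid_policy M i (\<pi> i)" and "t \<le> horizon M"
  shows "\<exists>w G. \<forall>\<phi>. (\<integral>\<^sup>+\<omega>. (if env_history \<omega> = es then \<Prod>i\<in>UNIV. \<phi> i (agent_history i \<omega>) else 0)
       \<partial>measure_pmf (process M J \<pi> t)) = w * (\<Prod>i\<in>UNIV. G i (\<phi> i))"
  using assms(2)
proof (induction t arbitrary: es)
  case 0
  show ?case
  proof (cases es rule: rev_cases)
    \<comment> \<open>No history of the process is empty, so the integrand vanishes almost surely
      and the weight 0 will do.\<close>
    case Nil
    have "(\<integral>\<^sup>+\<omega>. (if env_history \<omega> = es then \<Prod>i\<in>UNIV. \<phi> i (agent_history i \<omega>) else 0)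
       \<partial>measure_pmf (process M J \<pi> 0)) = 0" for \<phi> :: "'i \<Rightarrow> _"
      using process_support[OF \<pi>, of 0] Nil
      by (subst nn_integral_0_iff_AE)
        (force simp: AE_measure_pmf_iff env_history_def simp del: process.simps)+
    then show ?thesis
      by (intro exI[of _ 0]) simp
  next
    \<comment> \<open>A history at time 0 has a single entry, so the weight is 0 unless
      \<open>es'\<close> is empty.\<close>
    case (snoc es' e)
    have "set_pmf (init_prob M) \<subseteq> states M"
      using valid by (simp add: valid_dec_pomdp_def)
    note new_state = nn_integral_new_state_extend[OF this init_prob_eq, where h = "[]" and \<pi> = \<pi>]
    have "(\<integral>\<^sup>+\<omega>. (if env_history \<omega> = es then \<Prod>i\<in>UNIV. \<phi> i (agent_history i \<omega>) else 0)
        \<partial>measure_pmf (process M J \<pi> 0)) =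
      (if es' = [] then ennreal (pmf \<mu>_env e) else 0) *
      (\<Prod>i\<in>UNIV. \<integral>\<^sup>+l. agent_step_integral (\<pi> i) [] (emit_loc i e l) l (\<phi> i) \<partial>measure_pmf (\<mu>_loc i))"
      for \<phi>
      using new_state[of es' e \<phi>]
      by (cases "es' = []") (simp_all add: snoc agent_history_def env_history_def)
    then show ?thesis
      by (intro exI[of _ "if es' = [] then ennreal (pmf \<mu>_env e) else 0"]
          exI[of _ "\<lambda>i \<phi>. \<integral>\<^sup>+l. agent_step_integral (\<pi> i) [] (emit_loc i e l) l \<phi>
            \<partial>measure_pmf (\<mu>_loc i)"]) blast
  qed
next
  case (Suc t)
  show ?case
  proof (cases es rule: rev_cases)
    case Nil
    have "(\<integral>\<^sup>+\<omega>. (if env_history \<omega> = es then \<Prod>i\<in>UNIV. \<phi> i (agent_history i \<omega>) else 0)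
       \<partial>measure_pmf (process M J \<pi> (Suc t))) = 0" for \<phi> :: "'i \<Rightarrow> _"
      using process_support[OF \<pi> Suc.prems] Nil
      by (subst nn_integral_0_iff_AE)
        (force simp: AE_measure_pmf_iff env_history_def simp del: process.simps)+
    then show ?thesis
      by (intro exI[of _ 0]) simp
  next
    case (snoc es' e)
    \<comment> \<open>The pullback of \<open>\<phi>\<close> along one step of agent
      \<open>i\<close>: the next local state is drawn from the last local state and action in
      \<open>k\<close>.\<close>
    define \<psi> where "\<psi> i \<phi> k =
      (\<integral>\<^sup>+l. agent_step_integral (\<pi> i) k (emit_loc i e l) l \<phi>
         \<partial>measure_pmf (P_loc i (fst (last k)) (snd (snd (last k)))))" for i \<phi> k
    \<comment> \<open>\<open>w\<close> and \<open>G\<close> are fixed before the test functions, so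
      this can later be applied to \<open>\<psi> i (\<phi> i)\<close>.\<close>
    obtain w G where wG: "\<And>\<phi>. (\<integral>\<^sup>+h. (if env_history h = es' then \<Prod>i\<in>UNIV. \<phi> i (agent_history i h) else 0)
       \<partial>measure_pmf (process M J \<pi> t)) = w * (\<Prod>i\<in>UNIV. G i (\<phi> i))"
      using Suc.IH[of es'] Suc.prems by auto
    have step: "(\<integral>\<^sup>+s. \<integral>\<^sup>+\<omega>. (if env_history \<omega> = es then \<Prod>i\<in>UNIV. \<phi> i (agent_history i \<omega>) else 0)
         \<partial>measure_pmf (extend J \<pi> h s)
         \<partial>measure_pmf (trans_prob M (step_state (last h)) (\<lambda>i. step_act i (last h)))) =
        ennreal (pmf (P_env (last es')) e) *
          (if env_history h = es' then \<Prod>i\<in>UNIV. \<psi> i (\<phi> i) (agent_history i h) else 0)"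
      if h: "h \<in> set_pmf (process M J \<pi> t)" for h \<phi>
    proof -
      have hv: "length h = Suc t" "valid_history h"
        using process_support[OF \<pi> _ h] Suc.prems by auto
      then have "h \<noteq> []" by auto
      obtain se sl where last: "step_state (last h) = (se, sl)"
        by (cases "step_state (last h)")
      have "(se, sl) \<in> states M" "\<forall>i. step_act i (last h) \<in> acts M i"
        using hv(2) last last_in_set[OF \<open>h \<noteq> []\<close>] by (force simp: valid_history_def)+
      note trans = trans_prob_eq[OF this]
      \<comment> \<open>On the histories that count, the current environment state is read off from
        \<open>es'\<close>, so the probability of moving to \<open>e\<close> is a constant factor of
        the integral.\<close>
      have "se = last es'" if "env_history h = es'"
        using that last \<open>h \<noteq> []\<close> by (auto simp: env_history_def last_map)
      moreover have "last (agent_history i h) = (sl i, step_obs i (last h), step_act i (last h))" for i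
        using last \<open>h \<noteq> []\<close> by (simp add: agent_history_def last_map)
      ultimately show ?thesis
        using nn_integral_new_state_extend[OF trans_prob_last_subset[OF hv(2) \<open>h \<noteq> []\<close>] trans[folded last],
            where h = h and \<pi> = \<pi> and es = es' and e = e and \<phi> = \<phi>]
        by (auto simp: snoc \<psi>_def)
    qed
    have "(\<integral>\<^sup>+\<omega>. (if env_history \<omega> = es then \<Prod>i\<in>UNIV. \<phi> i (agent_history i \<omega>) else 0)
         \<partial>measure_pmf (process M J \<pi> (Suc t))) =
        (ennreal (pmf (P_env (last es')) e) * w) * (\<Prod>i\<in>UNIV. G i (\<psi> i (\<phi> i)))" for \<phi>
    proof -
      have "(\<integral>\<^sup>+\<omega>. (if env_history \<omega> = es then \<Prod>i\<in>UNIV. \<phi> i (agent_history i \<omega>) else 0)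
         \<partial>measure_pmf (process M J \<pi> (Suc t))) =
        (\<integral>\<^sup>+h. ennreal (pmf (P_env (last es')) e) *
          (if env_history h = es' then \<Prod>i\<in>UNIV. \<psi> i (\<phi> i) (agent_history i h) else 0)
          \<partial>measure_pmf (process M J \<pi> t))"
        using step by (auto intro!: nn_integral_cong_AE AE_pmfI)
      also have "\<dots> = ennreal (pmf (P_env (last es')) e) * (w * (\<Prod>i\<in>UNIV. G i (\<psi> i (\<phi> i))))"
        by (subst nn_integral_cmult) (simp_all add: wG[of "\<lambda>i. \<psi> i (\<phi> i)"])
      finally show ?thesis
        by (simp add: mult.assoc)
    qed
    then show ?thesis
      by (intro exI[of _ "ennreal (pmf (P_env (last es')) e) * w"] exI[of _ "\<lambda>i \<phi>. G i (\<psi> i \<phi>)"]) blast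
  qed
qed

text \<open>The test functions become indicators of sets of observation sequences. Sets rather than
  single sequences are taken so that \<open>UNIV\<close> can remove an agent from the event.\<close>

lemma trajectory_factorizes:
  assumes \<pi>: "\<forall>i. valid_policy M i (\<pi> i)"
  shows "\<exists>w G. \<forall>S. emeasure (measure_pmf (trajectory M J \<pi>))
      {\<omega>. env_seq M \<omega> = x \<and> (\<forall>i. map (\<lambda>t. step_obs i (\<omega> ! t)) [0..<Suc (horizon M)] \<in> S i)} =
    w * (\<Prod>i\<in>UNIV. G i (S i))"
proof -
  obtain w G where wG: "\<And>\<phi>. (\<integral>\<^sup>+\<omega>. (if env_history \<omega> = x then \<Prod>i\<in>UNIV. \<phi> i (agent_history i \<omega>) else 0)
       \<partial>measure_pmf (process M J \<pi> (horizon M))) = w * (\<Prod>i\<in>UNIV. G i (\<phi> i))"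
    using process_factorizes[OF \<pi> order_refl, of x] by auto
  define \<phi> :: "'o list set \<Rightarrow> ('l \<times> 'o \<times> 'a) list \<Rightarrow> ennreal"
    where "\<phi> s k = indicator s (map (\<lambda>x. fst (snd x)) k)" for s k
  have prod_indicator: "(\<Prod>i\<in>UNIV. indicator (S i) (k i)) = (if \<forall>i. k i \<in> S i then 1 else (0 :: ennreal))"
    for S :: "'i \<Rightarrow> 'o list set" and k
    by (auto simp: indicator_def)
  have "emeasure (measure_pmf (trajectory M J \<pi>))
      {\<omega>. env_seq M \<omega> = x \<and> (\<forall>i. map (\<lambda>t. step_obs i (\<omega> ! t)) [0..<Suc (horizon M)] \<in> S i)} =
    w * (\<Prod>i\<in>UNIV. G i (\<phi> (S i)))" (is "emeasure _ ?E = _") for S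
  proof -
    have "emeasure (measure_pmf (trajectory M J \<pi>)) ?E =
        (\<integral>\<^sup>+\<omega>. indicator ?E \<omega> \<partial>measure_pmf (process M J \<pi> (horizon M)))"
      by (simp add: trajectory_def)
    also have "\<dots> = (\<integral>\<^sup>+\<omega>. (if env_history \<omega> = x then \<Prod>i\<in>UNIV. \<phi> (S i) (agent_history i \<omega>) else 0)
       \<partial>measure_pmf (process M J \<pi> (horizon M)))"
    proof (rule nn_integral_cong_AE, rule AE_pmfI)
      fix \<omega>
      assume "\<omega> \<in> set_pmf (process M J \<pi> (horizon M))"
      then have len: "length \<omega> = Suc (horizon M)"
        using process_support[OF \<pi> order_refl] by blast
      \<comment> \<open>Indexing by the fixed time list and mapping over the list itself agree
        because this \<open>\<omega>\<close> has exactly \<open>Suc (horizon M)\<close>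
        entries.\<close>
      have "env_seq M \<omega> = env_history \<omega>"
        "map (\<lambda>t. step_obs i (\<omega> ! t)) [0..<Suc (horizon M)] = map (\<lambda>x. fst (snd x)) (agent_history i \<omega>)" for i
        using len by (auto simp: env_seq_def env_history_def agent_history_def
            intro!: nth_equalityI simp del: upt_Suc)
      then show "indicator ?E \<omega> =
          (if env_history \<omega> = x then \<Prod>i\<in>UNIV. \<phi> (S i) (agent_history i \<omega>) else 0)"
        by (simp add: \<phi>_def prod_indicator del: upt_Suc)
    qed
    also have "\<dots> = w * (\<Prod>i\<in>UNIV. G i (\<phi> (S i)))"
      by (rule wG)
    finally show ?thesis .
  qed
  then show ?thesis
    by (intro exI[of _ w] exI[of _ "\<lambda>i s. G i (\<phi> s)"]) blast
qed

end

section \<open>Conditional independence of the observation sequences\<close>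

text \<open>All four events are boxes. Since \<open>j \<notin> A\<close>, at each agent at least one
  of \<open>Sj\<close> and \<open>SA\<close> is \<open>UNIV\<close>, so the intersection and
  \<open>UNIV\<close> contribute the same two factors as \<open>Sj\<close> and \<open>SA\<close>; no
  division by \<open>w\<close> occurs.\<close>

lemma cond_indep_if_factorizes:
  fixes p :: "'w pmf" and Y :: "'i::finite \<Rightarrow> 'w \<Rightarrow> 'c"
  assumes fact: "\<exists>w G. \<forall>S. emeasure (measure_pmf p) {\<omega>. X \<omega> = x \<and> (\<forall>i. Y i \<omega> \<in> S i)} =
      w * (\<Prod>i\<in>UNIV. G i (S i))"
    and j: "j \<notin> A"
  shows "measure_pmf.prob p {\<omega>. Y j \<omega> = y \<and> (\<lambda>i\<in>A. Y i \<omega>) = u \<and> X \<omega> = x} * measure_pmf.prob p {\<omega>. X \<omega> = x} =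
    measure_pmf.prob p {\<omega>. Y j \<omega> = y \<and> X \<omega> = x} * measure_pmf.prob p {\<omega>. (\<lambda>i\<in>A. Y i \<omega>) = u \<and> X \<omega> = x}"
proof (cases "u \<in> extensional A")
  \<comment> \<open>A restricted family is always extensional, so such a \<open>u\<close> is never
    attained.\<close>
  case False
  then have "{\<omega>. Y j \<omega> = y \<and> (\<lambda>i\<in>A. Y i \<omega>) = u \<and> X \<omega> = x} = {}" "{\<omega>. (\<lambda>i\<in>A. Y i \<omega>) = u \<and> X \<omega> = x} = {}"
    by auto
  then show ?thesis
    by (simp only: measure_empty mult_zero_left mult_zero_right)
next
  case True
  obtain w G where wG: "\<And>S. emeasure (measure_pmf p) {\<omega>. X \<omega> = x \<and> (\<forall>i. Y i \<omega> \<in> S i)} =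
      w * (\<Prod>i\<in>UNIV. G i (S i))"
    using fact by auto
  define Sj where "Sj i = (if i = j then {y} else UNIV)" for i
  define SA where "SA i = (if i \<in> A then {u i} else UNIV)" for i
  have u: "(\<lambda>i\<in>A. Y i \<omega>) = u \<longleftrightarrow> (\<forall>i\<in>A. Y i \<omega> = u i)" for \<omega>
    using True by (auto simp: fun_eq_iff extensional_def)
  have events: "{\<omega>. Y j \<omega> = y \<and> (\<lambda>i\<in>A. Y i \<omega>) = u \<and> X \<omega> = x} = {\<omega>. X \<omega> = x \<and> (\<forall>i. Y i \<omega> \<in> Sj i \<inter> SA i)}"
    "{\<omega>. Y j \<omega> = y \<and> X \<omega> = x} = {\<omega>. X \<omega> = x \<and> (\<forall>i. Y i \<omega> \<in> Sj i)}"
    "{\<omega>. (\<lambda>i\<in>A. Y i \<omega>) = u \<and> X \<omega> = x} = {\<omega>. X \<omega> = x \<and> (\<forall>i. Y i \<omega> \<in> SA i)}"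
    "{\<omega>. X \<omega> = x} = {\<omega>. X \<omega> = x \<and> (\<forall>i. Y i \<omega> \<in> (\<lambda>_. UNIV) i)}"
    unfolding u Sj_def SA_def by (auto split: if_splits)
  have swap: "w * k * (w * l) = w * m * (w * n)" if "k * l = m * n" for k l m n
    using arg_cong[OF that, of "\<lambda>x. w * w * x"] by (simp add: ac_simps)
  have "(\<Prod>i\<in>UNIV. G i (Sj i \<inter> SA i)) * (\<Prod>i\<in>UNIV. G i UNIV) =
      (\<Prod>i\<in>UNIV. G i (Sj i)) * (\<Prod>i\<in>UNIV. G i (SA i))"
    unfolding prod.distrib[symmetric] using j
    by (intro prod.cong) (auto simp: Sj_def SA_def mult.commute)
  then have "emeasure (measure_pmf p) {\<omega>. X \<omega> = x \<and> (\<forall>i. Y i \<omega> \<in> Sj i \<inter> SA i)} *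
      emeasure (measure_pmf p) {\<omega>. X \<omega> = x \<and> (\<forall>i. Y i \<omega> \<in> (\<lambda>_. UNIV) i)} =
    emeasure (measure_pmf p) {\<omega>. X \<omega> = x \<and> (\<forall>i. Y i \<omega> \<in> Sj i)} *
      emeasure (measure_pmf p) {\<omega>. X \<omega> = x \<and> (\<forall>i. Y i \<omega> \<in> SA i)}"
    unfolding wG by (rule swap)
  then show ?thesis
    unfolding events by (simp only: measure_pmf.emeasure_eq_measure
        ennreal_mult'[OF measure_nonneg, symmetric] ennreal_inj measure_nonneg mult_nonneg_nonneg)
qed

section \<open>Finite ranges, bounds on the ratio, and assembly\<close>

lemma simple_function_measure_pmf:
  "finite (range X) \<Longrightarrow> simple_function (measure_pmf p) X"
  by (simp add: simple_function_def)

lemma finite_lists_of_length: "finite {xs :: 'b::finite list. length xs = n}"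
  using finite_lists_length_eq[of "UNIV :: 'b set" n] by simp

lemma finite_range_env_seq:
  "finite (range (env_seq (M :: ('e::finite \<times> ('i \<Rightarrow> 'l), 'i, 'a, 'o) dec_pomdp)))"
  by (rule finite_subset[OF _ finite_lists_of_length[of "Suc (horizon M)"]])
    (auto simp: env_seq_def simp del: upt_Suc)

lemma finite_range_obs_seqs:
  "finite (range (obs_seqs (M :: ('s, 'i::finite, 'a, 'o::finite) dec_pomdp) A))"
  by (rule finite_subset[OF _ finite_PiE[of A "\<lambda>_. {xs. length xs = Suc (horizon M)}"]])
    (auto simp: obs_seqs_def finite_lists_of_length simp del: upt_Suc)

text \<open>The lower bound amounts to \<open>c A\<close> being at most the largest ratio times
  \<open>h A\<close>; the upper bound already follows from \<open>g A \<le> h A\<close>.\<close>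

lemma max_ratio_bounds:
  fixes g h c :: "'i::finite set \<Rightarrow> real"
  assumes sum: "\<And>A. h A = g A + c A" and g: "\<And>A. 0 \<le> g A" and c: "\<And>A. 0 \<le> c A"
  shows "(1 - max_ratio c h) * h A \<le> g A" "g A \<le> (1 + max_ratio c h) * h A"
    and "max_ratio c h \<in> {0..1}" "0 < max_ratio c h \<longleftrightarrow> (\<exists>A. 0 < c A)"
proof -
  have h: "0 \<le> h A" and c_le: "c A \<le> h A" for A
    using g[of A] c[of A] sum[of A] by simp_all
  have ratio_le: "c A / h A \<le> max_ratio c h" for A
    unfolding max_ratio_def by (rule Max_ge) auto
  have ratio: "0 \<le> c A / h A" "c A / h A \<le> 1" for A
    using h[of A] c[of A] c_le[of A] by (auto simp: divide_le_eq_1)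
  show nonneg: "max_ratio c h \<in> {0..1}"
    using order.trans[OF ratio(1) ratio_le] ratio(2) by (simp add: max_ratio_def)
  \<comment> \<open>\<open>h A = 0\<close> forces \<open>c A = 0\<close>, so the convention for
    division by 0 does no harm.\<close>
  have "c A \<le> max_ratio c h * h A"
    using ratio_le[of A] h[of A] c_le[of A] by (cases "h A = 0") (auto simp: divide_le_eq)
  then show "(1 - max_ratio c h) * h A \<le> g A"
    using sum[of A] by (simp add: algebra_simps)
  have "0 \<le> max_ratio c h * h A"
    using nonneg h[of A] by simp
  then show "g A \<le> (1 + max_ratio c h) * h A"
    using sum[of A] c[of A] by (simp add: algebra_simps)
  show "0 < max_ratio c h \<longleftrightarrow> (\<exists>A. 0 < c A)"
  proof
    assume pos: "0 < max_ratio c h"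
    \<comment> \<open>The maximum is attained, since there are only finitely many sets of
      agents.\<close>
    have "max_ratio c h \<in> range (\<lambda>A. c A / h A)"
      unfolding max_ratio_def by (rule Max_in) auto
    then obtain A where "max_ratio c h = c A / h A"
      by blast
    then have "c A \<noteq> 0"
      using pos by auto
    then show "\<exists>A. 0 < c A"
      using c[of A] by (auto simp: less_le)
  next
    assume "\<exists>A. 0 < c A"
    then obtain A where "0 < c A" ..
    then have "0 < c A / h A"
      using c_le[of A] by auto
    then show "0 < max_ratio c h"
      using ratio_le[of A] by simp
  qed
qed

text \<open>Positivity of \<epsilon> is stated as an equivalence because \<epsilon> can be 0: if
  \<open>f\<close> is injective, the secret determines the environment path, every
  \<open>c A\<close> vanishes, and \<open>g\<close> equals \<open>h\<close>.\<close>

theorem lemma6: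
  fixes M :: "('e::finite \<times> ('i::finite \<Rightarrow> 'l::finite), 'i, 'a::finite, 'o::finite) dec_pomdp"
    and J :: "'e \<times> ('i \<Rightarrow> 'l) \<Rightarrow> ('i \<Rightarrow> 'o) pmf"
    and Env :: "'e set"
    and Loc :: "'i \<Rightarrow> 'l set"
    and P_env :: "'e \<Rightarrow> 'e pmf"
    and P_loc :: "'i \<Rightarrow> 'l \<Rightarrow> 'a \<Rightarrow> 'l pmf"
    and \<mu>_env :: "'e pmf"
    and \<mu>_loc :: "'i \<Rightarrow> 'l pmf"
    and \<pi> :: "'i \<Rightarrow> ('a, 'o) policy"
    and f :: "'e list \<Rightarrow> 'z"
    and Zs :: "'z set"
    and b :: real
    and g h c :: "'i set \<Rightarrow> real"
    and \<epsilon> :: real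
  assumes model: "factored_dec_pomdp M J Env Loc P_env P_loc \<mu>_env \<mu>_loc"
    and policies: "\<forall>i. valid_policy M i (\<pi> i)"
    and f_surj: "f ` {es. set es \<subseteq> Env \<and> length es = Suc (horizon M)} = Zs"
    and base: "b > 1"
  defines "g \<equiv> \<lambda>A. mutual_info b (trajectory M J \<pi>) (\<lambda>\<omega>. f (env_seq M \<omega>)) (obs_seqs M A)"
    and "h \<equiv> \<lambda>A. mutual_info b (trajectory M J \<pi>) (env_seq M) (obs_seqs M A)"
    and "c \<equiv> \<lambda>A. cond_mutual_info b (trajectory M J \<pi>) (env_seq M) (obs_seqs M A)
                   (\<lambda>\<omega>. f (env_seq M \<omega>))"
    and "\<epsilon> \<equiv> max_ratio c h"
  shows "mono g \<and>
    submodular h \<and>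
    (\<forall>A. (1 - \<epsilon>) * h A \<le> g A \<and> g A \<le> (1 + \<epsilon>) * h A) \<and>
    \<epsilon> \<in> {0..1} \<and>
    (\<epsilon> \<in> {0<..1} \<longleftrightarrow> (\<exists>A. c A > 0))"
proof -
  interpret factored_dec_pomdp M J Env Loc P_env P_loc \<mu>_env \<mu>_loc
    by (rule model)
  interpret information_space "measure_pmf (trajectory M J \<pi>)" b
    by unfold_locales (rule base)
  let ?p = "trajectory M J \<pi>"
  have X: "simple_function (measure_pmf ?p) (env_seq M)"
    by (intro simple_function_measure_pmf finite_range_env_seq)
  have Y: "simple_function (measure_pmf ?p) (obs_seqs M A)" for A
    by (intro simple_function_measure_pmf finite_range_obs_seqs)
  have Z: "simple_function (measure_pmf ?p) (\<lambda>\<omega>. f (env_seq M \<omega>))"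
    using simple_function_compose[OF X, of f] by (simp add: comp_def)
  have "mono g"
  proof (rule monoI)
    fix A B :: "'i set"
    assume "A \<le> B"
    \<comment> \<open>The observations of \<open>A\<close> are a restriction of those of
      \<open>B\<close>, hence a function of them.\<close>
    then have "obs_seqs M A = (\<lambda>\<omega>. \<lambda>i\<in>A. obs_seqs M B \<omega> i)"
      by (auto simp: obs_seqs_def restrict_def fun_eq_iff)
    then show "g A \<le> g B"
      using mutual_information_data_processing[OF Z Y[of B], of "\<lambda>F. \<lambda>i\<in>A. F i"] by (simp add: g_def)
  qed
  moreover have "submodular h"
  proof -
    have "submodular (\<lambda>A. mutual_info b ?p (env_seq M)
        (\<lambda>\<omega>. \<lambda>i\<in>A. map (\<lambda>t. step_obs i (\<omega> ! t)) [0..<Suc (horizon M)]))"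
    proof (rule submodular_mutual_information_cond_indep[OF X])
      show "simple_function (measure_pmf ?p)
          (\<lambda>\<omega>. \<lambda>i\<in>A. map (\<lambda>t. step_obs i (\<omega> ! t)) [0..<Suc (horizon M)])" for A
        using Y[of A] by (simp add: obs_seqs_def[abs_def] del: upt_Suc)
    qed (use cond_indep_if_factorizes[OF trajectory_factorizes[OF policies]] in
        \<open>simp del: upt_Suc\<close>)
    then show ?thesis
      by (simp add: h_def obs_seqs_def[abs_def] del: upt_Suc)
  qed
  moreover have "h A = g A + c A" for A
    unfolding h_def g_def c_def by (rule mutual_information_chain_rule[OF X Y])
  moreover have "0 \<le> g A" "0 \<le> c A" for A
    unfolding g_def c_def
    by (intro mutual_information_nonneg_simple conditional_mutual_information_nonneg X Y Z)+
  ultimately show ?thesis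
    using max_ratio_bounds[of h g c] unfolding \<epsilon>_def by auto
qed

end
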